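(* Let $g\ge 2$ be an integer, $n>0$ and $\sigma>0$. For a design $\xi=((x_0,\dots,x_{g-1}),(n_0,\dots,n_{g-1}))$, with nodes $-1\le x_0<\dots<x_{g-1}\le 1$ and real frequencies $n_j>0$ satisfying $\sum_{j=0}^{g-1}n_j=n$, put $$V_\xi(x)=\sigma^2\sum_{j=0}^{g-1}\frac{l_j(x)^2}{n_j},\qquad l_j(x)=\prod_{k\ne j}\frac{x-x_k}{x_j-x_k}.$$ Let $P_{g-1}$ be the Legendre polynomial of degree $g-1$. Then the optimal design $\xi^*$, i.e. the (unique) solution of $$\min_{\xi}\ \max_{x\in[-1,1]}V_\xi(x),$$ where the minimum is over all designs $\xi=((x_0,\dots,x_{g-1}),(n_0,\dots,n_{g-1}))$ with $-1\le x_0<\dots<x_{g-1}\le 1$, real $n_j>0$ and $\sum_{j=0}^{g-1}n_j=n$, is the design whose nodes are $-1$, $1$ and the $g-2$ solutions of $\frac{d}{dx}P_{g-1}(x)=0$, and whose frequencies are $n_j=\frac{n}{g}$ for $j=0,\dots,g-1$.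
   Context: The Legendre polynomial is $P_{g-1}(x)=\frac{1}{2^{g-1}(g-1)!}\frac{d^{g-1}}{dx^{g-1}}(x^2-1)^{g-1}$. $V_\xi(x)$ is the variance at $x$ of the unbiased estimator $\sum_j \overline{Y}(x_j)l_j(x)$ of a polynomial $f$ of degree at most $g-1$, where $\overline Y(x_j)$ is the mean of $n_j$ independent observations of $f(x_j)$ with additive centered noise of variance $\sigma^2$. Frequencies are allowed to be positive real numbers (real relaxation of the integer problem). *)

theory Defs
  imports "HOL-Analysis.Analysis" "HOL-Computational_Algebra.Polynomial"
begin

definition legendre_poly :: "nat \<Rightarrow> real poly" where
  "legendre_poly m = smult (1 / (2 ^ m * fact m)) ((pderiv ^^ m) ([:-1, 0, 1:] ^ m))"

definition lagrange_basis :: "real list \<Rightarrow> nat \<Rightarrow> real \<Rightarrow> real" where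
  "lagrange_basis xs j x = (\<Prod>k\<in>{..<length xs} - {j}. (x - xs ! k) / (xs ! j - xs ! k))"

(* A design is a pair (nodes, frequencies) of lists of length g, so that equality of
   designs is equality of all nodes and all frequencies. *)
type_synonym design = "real list \<times> real list"

definition designs :: "nat \<Rightarrow> real \<Rightarrow> design set" where
  "designs g n =
     {(xs, ns). length xs = g \<and> length ns = g \<and>
                sorted_wrt (<) xs \<and> set xs \<subseteq> {-1..1} \<and>
                (\<forall>j<g. ns ! j > 0) \<and> (\<Sum>j<g. ns ! j) = n}"

definition estimator_variance :: "real \<Rightarrow> design \<Rightarrow> real \<Rightarrow> real" where
  "estimator_variance \<sigma> = (\<lambda>(xs, ns) x.
     \<sigma>\<^sup>2 * (\<Sum>j<length xs. (lagrange_basis xs j x)\<^sup>2 / ns ! j))"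

definition max_variance :: "real \<Rightarrow> design \<Rightarrow> real" where
  "max_variance \<sigma> \<xi> = (SUP x\<in>{-1..1}. estimator_variance \<sigma> \<xi> x)"

lemma continuous_on_estimator_variance:
  "continuous_on A (estimator_variance \<sigma> \<xi>)"
  by (cases \<xi>)
     (simp add: estimator_variance_def lagrange_basis_def divide_inverse continuous_intros)

(* The supremum in max_variance is a maximum. *)
lemma max_variance_attained:
  "\<exists>x\<in>{-1..1}. max_variance \<sigma> \<xi> = estimator_variance \<sigma> \<xi> x \<and>
     (\<forall>y\<in>{-1..1}. estimator_variance \<sigma> \<xi> y \<le> max_variance \<sigma> \<xi>)"
proof -
  obtain x where x: "x \<in> {-1..1::real}"
    "\<forall>y\<in>{-1..1}. estimator_variance \<sigma> \<xi> y \<le> estimator_variance \<sigma> \<xi> x"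
    using continuous_attains_sup[of "{-1..1::real}" "estimator_variance \<sigma> \<xi>"]
      continuous_on_estimator_variance by auto
  then have "max_variance \<sigma> \<xi> = estimator_variance \<sigma> \<xi> x"
    unfolding max_variance_def by (intro cSup_eq_maximum) auto
  with x show ?thesis by auto
qed

definition optimal_design :: "nat \<Rightarrow> real \<Rightarrow> real \<Rightarrow> design \<Rightarrow> bool" where
  "optimal_design g n \<sigma> = is_arg_min (max_variance \<sigma>) (\<lambda>\<xi>. \<xi> \<in> designs g n)"

end

theory Submission
  imports Defs
begin

text \<open>
  Write m = g - 1. At its own nodes a design has variance \<open>\<sigma>\<^sup>2 / n\<^sub>j\<close>, and some frequency is at
  most n / g, so the maximal variance is at least \<open>\<sigma>\<^sup>2 g / n\<close>. Equality forces equal frequencies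
  together with Fejer's condition \<open>F = \<Sum> l\<^sub>j\<^sup>2 \<le> 1\<close> on [-1, 1]. The polynomial 1 - F has degree 2m
  and negative leading coefficient, vanishes at all m + 1 nodes and, under Fejer's condition,
  doubly at the interior ones. Counting zeros shows that -1 and 1 must be nodes; conversely, double
  zeros at the interior nodes determine 1 - F up to a constant and hence its sign. With \<open>\<omega>\<close> the
  node polynomial, F' vanishes at a node iff \<open>\<omega>''\<close> does, so the condition becomes the differential
  equation \<open>(x\<^sup>2 - 1) \<omega>'' = m (m + 1) \<omega>\<close>, whose solutions of degree m + 1 are the multiples of
  \<open>(x\<^sup>2 - 1) P\<^sub>m'\<close>.
\<close>

section \<open>The sum of squared Lagrange polynomials\<close>

definition omega :: "real set \<Rightarrow> real poly" where
  "omega A = (\<Prod>a\<in>A. [:- a, 1:])"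

definition lagrange_poly :: "real set \<Rightarrow> real \<Rightarrow> real poly" where
  "lagrange_poly A a = smult (1 / poly (omega (A - {a})) a) (omega (A - {a}))"

definition fejer_poly :: "real set \<Rightarrow> real poly" where
  "fejer_poly A = (\<Sum>a\<in>A. (lagrange_poly A a)\<^sup>2)"

section \<open>Node polynomials and divisibility by products of linear factors\<close>

lemma poly_omega: "finite A \<Longrightarrow> poly (omega A) x = 0 \<longleftrightarrow> x \<in> A"
  by (auto simp: omega_def poly_prod)

lemma degree_omega: "degree (omega A) = card A"
  unfolding omega_def by (subst degree_prod_eq_sum_degree) auto

lemma lead_coeff_omega: "lead_coeff (omega A) = 1"
  unfolding omega_def by (simp add: lead_coeff_prod)

lemma omega_remove: "finite A \<Longrightarrow> a \<in> A \<Longrightarrow> omega A = [:- a, 1:] * omega (A - {a})"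
  unfolding omega_def by (rule prod.remove)

text \<open>The other factors do not vanish at \<open>a\<close>, so the full order of
  \<open>p\<close> at \<open>a\<close> passes to the cofactor \<open>r\<close>. The exponent depends
  on the node because endpoints will count once and interior nodes twice.\<close>

lemma prod_linear_powers_dvd:
  fixes p :: "real poly"
  assumes "finite A" "\<And>a. a \<in> A \<Longrightarrow> [:- a, 1:] ^ e a dvd p"
  shows "(\<Prod>a\<in>A. [:- a, 1:] ^ e a) dvd p"
  using assms
proof (cases "p = 0")
  case False
  from assms show ?thesis
  proof (induction A)
    case (insert a A)
    then obtain r where r: "p = (\<Prod>b\<in>A. [:- b, 1:] ^ e b) * r" by auto
    have "poly (\<Prod>b\<in>A. [:- b, 1:] ^ e b) a \<noteq> 0"
      using insert.hyps by (auto simp: poly_prod poly_power)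
    then have "order a p = order a r" using False unfolding r by (simp add: order_mult order_0I)
    moreover have "[:- a, 1:] ^ e a dvd p" using insert.prems by simp
    ultimately have "[:- a, 1:] ^ e a dvd r" using False by (auto simp: order_divides)
    then show ?case using insert.hyps r by (simp add: mult_dvd_mono mult.commute)
  qed simp
qed simp

lemma omega_dvd: "finite A \<Longrightarrow> (\<And>a. a \<in> A \<Longrightarrow> poly p a = 0) \<Longrightarrow> omega A dvd p"
  using prod_linear_powers_dvd[of A "\<lambda>_. 1" p] by (simp add: omega_def poly_eq_0_iff_dvd)

lemma dvd_same_degree:
  fixes p q :: "real poly"
  assumes "q dvd p" "p \<noteq> 0" "degree p \<le> degree q"
  obtains c where "c \<noteq> 0" "p = smult c q"
proof -
  obtain r where r: "p = q * r" using assms(1) by auto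
  with assms(2) have "q \<noteq> 0" "r \<noteq> 0" by auto
  then have "degree p = degree q + degree r" using r by (simp add: degree_mult_eq)
  then have "degree r = 0" using assms(3) by simp
  then obtain c where "r = [:c:]" by (rule degree_eq_zeroE)
  with r \<open>r \<noteq> 0\<close> show ?thesis using that[of c] by auto
qed

lemma square_linear_dvd:
  fixes p :: "real poly"
  assumes "poly p a = 0" "poly (pderiv p) a = 0"
  shows "[:- a, 1:]\<^sup>2 dvd p"
proof -
  obtain q where q: "p = [:- a, 1:] * q" using assms(1) by (auto simp: poly_eq_0_iff_dvd)
  have "poly q a = 0" using assms(2) unfolding q pderiv_mult by (simp add: pderiv_pCons)
  then show ?thesis unfolding q power2_eq_square poly_eq_0_iff_dvd by (rule mult_dvd_mono[OF dvd_refl])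
qed

section \<open>Values, derivative and leading term of the sum of squares\<close>

lemma degree_lagrange_poly:
  assumes "finite A" "a \<in> A"
  shows "degree (lagrange_poly A a) = card A - 1"
  using assms by (simp add: lagrange_poly_def degree_omega poly_omega)

lemma poly_lagrange_poly:
  assumes "finite A" "a \<in> A" "b \<in> A"
  shows "poly (lagrange_poly A a) b = (if a = b then 1 else 0)"
  using assms by (auto simp: lagrange_poly_def poly_omega)

lemma poly_fejer_poly:
  assumes "finite A" "b \<in> A"
  shows "poly (fejer_poly A) b = 1"
proof -
  have "poly (fejer_poly A) b = (\<Sum>a\<in>A. if a = b then 1 else 0)"
    unfolding fejer_poly_def poly_sum using assms
    by (intro sum.cong) (auto simp: poly_lagrange_poly)
  then show ?thesis using assms by simp
qed

text \<open>Each summand \<open>2 l_a l_a'\<close> carries the factor \<open>l_a(b)\<close>, so only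
  \<open>a = b\<close> survives. Writing \<open>omega A = (x - b) r\<close> gives
  \<open>l_b = r / r(b)\<close> and \<open>omega''(b) = 2 r'(b)\<close>.\<close>

lemma pderiv_fejer_poly:
  assumes "finite A" "b \<in> A"
  shows "poly (pderiv (fejer_poly A)) b = poly (pderiv (pderiv (omega A))) b / poly (omega (A - {b})) b"
proof -
  have "poly (pderiv (fejer_poly A)) b
      = (\<Sum>a\<in>A. 2 * poly (lagrange_poly A a) b * poly (pderiv (lagrange_poly A a)) b)"
    by (simp add: fejer_poly_def higher_pderiv_sum[of 1, simplified] poly_sum power2_eq_square pderiv_mult mult.assoc)
  also have "\<dots> = (\<Sum>a\<in>A. if a = b then 2 * poly (pderiv (lagrange_poly A b)) b else 0)"
    using assms by (intro sum.cong) (auto simp: poly_lagrange_poly)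
  also have "\<dots> = 2 * poly (pderiv (omega (A - {b}))) b / poly (omega (A - {b})) b"
    using assms by (simp add: lagrange_poly_def pderiv_smult)
  also have "2 * poly (pderiv (omega (A - {b}))) b = poly (pderiv (pderiv (omega A))) b"
    unfolding omega_remove[OF assms] pderiv_mult pderiv_add by (simp add: pderiv_pCons)
  finally show ?thesis .
qed

lemma fejer_poly_top:
  assumes "finite A" "card A = m + 1"
  shows "degree (fejer_poly A) \<le> 2 * m" "coeff (fejer_poly A) (2 * m) > 0"
proof -
  have deg: "degree ((lagrange_poly A a)\<^sup>2) = 2 * m" if "a \<in> A" for a
  proof -
    have "lagrange_poly A a \<noteq> 0" using poly_lagrange_poly[OF assms(1) that that] by auto
    then show ?thesis using assms that degree_lagrange_poly[of A a] by (simp add: degree_power_eq)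
  qed
  show "degree (fejer_poly A) \<le> 2 * m"
    unfolding fejer_poly_def by (intro degree_sum_le) (auto simp: assms deg)
  have pos: "coeff ((lagrange_poly A a)\<^sup>2) (2 * m) > 0" if "a \<in> A" for a
  proof -
    have "lagrange_poly A a \<noteq> 0" using poly_lagrange_poly[OF assms(1) that that] by auto
    then have "(lead_coeff (lagrange_poly A a))\<^sup>2 > 0" by simp
    then show ?thesis using deg[OF that] by (metis lead_coeff_power)
  qed
  have "A \<noteq> {}" using assms by auto
  then show "coeff (fejer_poly A) (2 * m) > 0"
    unfolding fejer_poly_def coeff_sum using assms pos by (intro sum_pos) auto
qed

text \<open>Under either side the interior nodes are double zeros of \<open>D = 1 - F\<close>.
  Against degree \<open>2 * m\<close>, this count forces both endpoints into \<open>A\<close>; with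
  both there, it leaves \<open>D\<close> no further zeros.\<close>

lemma fejer_poly_le_one_iff:
  assumes A: "finite A" "card A = m + 1" "A \<subseteq> {-1..1}" and m: "m \<ge> 1"
  shows "(\<forall>x\<in>{-1..1}. poly (fejer_poly A) x \<le> 1) \<longleftrightarrow>
    {-1, 1} \<subseteq> A \<and> (\<forall>a\<in>A - {-1, 1}. poly (pderiv (pderiv (omega A))) a = 0)"
proof -
  define D where "D = 1 - fejer_poly A"
  \<comment> \<open>The multiplicity to be counted for a node as a zero of \<open>D\<close>: two for
    an interior extremum, only one for an endpoint.\<close>
  define e :: "real \<Rightarrow> nat" where "e = (\<lambda>a. if a \<in> {-1, 1} then 1 else 2)"
  define Q where "Q = (\<Prod>a\<in>A. [:- a, 1:] ^ e a)"
  have D_root: "poly D a = 0" if "a \<in> A" for a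
    using poly_fejer_poly[OF A(1) that] by (simp add: D_def)
  have D'_root: "poly (pderiv D) a = 0 \<longleftrightarrow> poly (pderiv (pderiv (omega A))) a = 0"
    if "a \<in> A" for a
    using that A(1) by (simp add: D_def pderiv_diff pderiv_fejer_poly poly_omega)
  \<comment> \<open>As \<open>m >= 1\<close>, the constant 1 has no coefficient at
    \<open>2 * m\<close>, so the top coefficient of \<open>D\<close> is that of
    \<open>-F\<close>.\<close>
  have top: "coeff D (2 * m) < 0" and "degree D \<le> 2 * m"
    using fejer_poly_top[OF A(1,2)] m by (auto simp: D_def intro: degree_diff_le)
  then have "D \<noteq> 0" by auto
  have Q_dvd: "Q dvd D"
    if "\<forall>a\<in>A - {-1, 1}. poly (pderiv (pderiv (omega A))) a = 0"
    unfolding Q_def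
  proof (rule prod_linear_powers_dvd[OF A(1)])
    fix a assume "a \<in> A"
    then show "[:- a, 1:] ^ e a dvd D"
      using that D_root D'_root square_linear_dvd[of D a]
      by (auto simp: e_def poly_eq_0_iff_dvd)
  qed
  have "degree Q = (\<Sum>a\<in>A. e a)"
    unfolding Q_def by (subst degree_prod_eq_sum_degree) (auto simp: degree_power_eq)
  moreover have "(\<Sum>a\<in>A. e a) + card (A \<inter> {-1, 1}) = (\<Sum>a\<in>A. e a + (if a \<in> {-1, 1} then 1 else 0))"
    using A(1) by (simp add: sum.distrib sum.If_cases Int_def)
  moreover have "\<dots> = (\<Sum>a\<in>A. 2)"
    by (intro sum.cong) (auto simp: e_def)
  ultimately have degQ: "degree Q + card (A \<inter> {-1, 1}) = 2 * m + 2"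
    using A(2) by simp
  show ?thesis
  proof (intro iffI conjI; (elim conjE)?)
    assume le: "\<forall>x\<in>{-1..1}. poly (fejer_poly A) x \<le> 1"
    show crit: "\<forall>a\<in>A - {-1, 1}. poly (pderiv (pderiv (omega A))) a = 0"
    proof
      fix a assume a: "a \<in> A - {-1, 1}"
      then have "-1 < a" "a < 1" using A(3) by force+
      \<comment> \<open>The radius is the distance to the nearer endpoint, so \<open>y\<close> stays
        where the bound on \<open>F\<close> holds and \<open>a\<close> is a local minimum of
        \<open>D\<close>.\<close>
      moreover have "poly D y \<ge> poly D a" if "\<bar>a - y\<bar> < min (1 - a) (1 + a)" for y
      proof -
        have "y \<in> {-1..1}" using that by auto
        then show ?thesis using le D_root[of a] a by (simp add: D_def)
      qed
      ultimately have "poly (pderiv D) a = 0"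
        using DERIV_local_min[OF poly_DERIV[of D a], of "min (1 - a) (1 + a)"] by auto
      then show "poly (pderiv (pderiv (omega A))) a = 0" using D'_root a by simp
    qed
    have "degree Q \<le> 2 * m"
      using dvd_imp_degree_le[OF Q_dvd[OF crit] \<open>D \<noteq> 0\<close>] \<open>degree D \<le> 2 * m\<close> by simp
    then have "card {-1, 1::real} \<le> card (A \<inter> {-1, 1})" using degQ by simp
    then have "A \<inter> {-1, 1} = {-1, 1}" by (intro card_seteq) auto
    then show "{-1, 1} \<subseteq> A" by auto
  next
    assume ends: "{-1, 1} \<subseteq> A"
      and crit: "\<forall>a\<in>A - {-1, 1}. poly (pderiv (pderiv (omega A))) a = 0"
    then have "A \<inter> {-1, 1} = {-1, 1}" by auto
    then have Q2: "degree Q = 2 * m" using degQ by simp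
    then obtain c where c: "D = smult c Q"
      using dvd_same_degree[OF Q_dvd[OF crit] \<open>D \<noteq> 0\<close>] \<open>degree D \<le> 2 * m\<close> by auto
    \<comment> \<open>As \<open>Q\<close> is monic, \<open>c\<close> is the negative top coefficient
      of \<open>D\<close>.\<close>
    have "lead_coeff Q = 1" by (simp add: Q_def lead_coeff_prod lead_coeff_power)
    then have "c < 0" using top Q2 c by simp
    show "\<forall>x\<in>{-1..1}. poly (fejer_poly A) x \<le> 1"
    proof
      fix x :: real assume x: "x \<in> {-1..1}"
      have "poly Q x = (\<Prod>a\<in>A - {-1, 1}. (x - a) ^ e a) * (\<Prod>a\<in>{-1, 1}. (x - a) ^ e a)"
        unfolding Q_def poly_prod using prod.subset_diff[OF ends A(1), of "\<lambda>a. (x - a) ^ e a"]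
        by (simp add: poly_power)
      moreover have "(\<Prod>a\<in>A - {-1, 1}. (x - a) ^ e a) \<ge> 0"
        by (intro prod_nonneg) (auto simp: e_def)
      moreover have "(\<Prod>a\<in>{-1, 1}. (x - a) ^ e a) \<le> 0"
        using x by (auto simp: e_def mult_le_0_iff)
      ultimately have "poly Q x \<le> 0" by (simp add: mult_nonneg_nonpos)
      then have "poly D x \<ge> 0" using \<open>c < 0\<close> by (simp add: c mult_nonpos_nonpos)
      then show "poly (fejer_poly A) x \<le> 1" by (simp add: D_def)
    qed
  qed
qed

section \<open>Critical points of Legendre polynomials\<close>

text \<open>Adding the largest zero \<open>a\<close> last, the mean value theorem gives a critical
  point between the old maximum and \<open>a\<close>. Confining all points strictly between
  \<open>Min A\<close> and \<open>Max A\<close> makes the new one distinct from the earlier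
  ones.\<close>

lemma rolle_roots:
  fixes p :: "real poly"
  assumes "finite A" "A \<noteq> {}" "\<And>a. a \<in> A \<Longrightarrow> poly p a = 0"
  shows "\<exists>B. finite B \<and> card B + 1 = card A \<and> B \<subseteq> {Min A<..<Max A} \<and>
    (\<forall>b\<in>B. poly (pderiv p) b = 0)"
  using assms
proof (induction A rule: finite_linorder_max_induct)
  case (insert a A)
  show ?case
  proof (cases "A = {}")
    case False
    then obtain B where B: "finite B" "card B + 1 = card A" "B \<subseteq> {Min A<..<Max A}"
      "\<forall>b\<in>B. poly (pderiv p) b = 0"
      using insert by auto
    have MaxA: "Max A \<in> A" "Max A < a" using False insert.hyps by auto
    obtain c where c: "Max A < c" "c < a" "poly (pderiv p) c = 0"
      using poly_MVT[of "Max A" a p] MaxA insert.prems by auto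
    have "c \<notin> B" using c B by auto
    moreover have "Max (insert a A) = a" "Min (insert a A) = Min A"
      using False insert.hyps MaxA Min_le[of A "Max A"] by auto
    moreover have "a \<notin> A" using insert.hyps by auto
    moreover have "Min A < c" using Min_le[of A "Max A"] MaxA insert.hyps c by linarith
    ultimately show ?thesis
      using B c MaxA insert.hyps by (intro exI[of _ "insert c B"]) auto
  qed auto
qed simp

section \<open>Repeated derivatives of \<open>(x^2 - 1)^m\<close>: factors, zeros, differential
  equation\<close>

lemma power_dvd_pderiv:
  fixes p q :: "real poly"
  assumes "q ^ Suc k dvd p"
  shows "q ^ k dvd pderiv p"
proof -
  obtain r where p: "p = q ^ Suc k * r" using assms by (rule dvdE)
  have "pderiv p = q ^ k * (q * pderiv r + r * smult (of_nat (Suc k)) (pderiv q))"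
    unfolding p pderiv_mult pderiv_power_Suc by (simp add: algebra_simps del: of_nat_Suc)
  then show ?thesis by simp
qed

text \<open>For \<open>k = m\<close> this is the Legendre polynomial without its normalising
  constant. A general \<open>k\<close> permits induction on the number of derivatives.\<close>

abbreviation rodrigues :: "nat \<Rightarrow> nat \<Rightarrow> real poly" where
  "rodrigues m k \<equiv> (pderiv ^^ k) ([:-1, 0, 1:] ^ m)"

lemma degree_rodrigues: "degree (rodrigues m k) = 2 * m - k"
  by (induction k) (simp_all add: degree_pderiv degree_power_eq)

lemma rodrigues_dvd: "k \<le> m \<Longrightarrow> [:-1, 0, 1:] ^ (m - k) dvd rodrigues m k"
proof (induction k)
  case (Suc k)
  then show ?case using power_dvd_pderiv[of "[:-1, 0, 1:]" "m - Suc k" "rodrigues m k"]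
    by (simp add: Suc_diff_Suc)
qed simp

text \<open>While \<open>k < m\<close> a factor \<open>x^2 - 1\<close> survives, so -1 and 1 join
  the \<open>k\<close> interior zeros. Rolle's theorem on these \<open>k + 2\<close> points gives
  \<open>k + 1\<close> zeros of the next derivative.\<close>

lemma rodrigues_roots:
  assumes "k \<le> m"
  shows "\<exists>B. finite B \<and> card B = k \<and> B \<subseteq> {-1<..<1} \<and> (\<forall>b\<in>B. poly (rodrigues m k) b = 0)"
  using assms
proof (induction k)
  case (Suc k)
  then obtain B where B: "finite B" "card B = k" "B \<subseteq> {-1<..<1}"
    "\<forall>b\<in>B. poly (rodrigues m k) b = 0" by auto
  have "[:-1, 0, 1:] dvd [:-1, 0, 1::real:] ^ (m - k)" using Suc.prems by (intro dvd_power) auto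
  then have "[:-1, 0, 1:] dvd rodrigues m k" using rodrigues_dvd[of k m] Suc.prems by (auto intro: dvd_trans)
  then have "poly (rodrigues m k) (-1) = 0" "poly (rodrigues m k) 1 = 0"
    by (auto elim!: dvdE)
  moreover have "card (insert (-1) (insert 1 B)) = k + 2"
    using B by (subst card_insert_disjoint; (subst card_insert_disjoint)?) auto
  moreover have "Min (insert (-1) (insert 1 B)) = -1"
    using B by (intro Min_eqI) force+
  moreover have "Max (insert (-1) (insert 1 B)) = 1"
    using B by (intro Max_eqI) force+
  ultimately show ?case
    using rolle_roots[of "insert (-1) (insert 1 B)" "rodrigues m k"] B by auto
qed auto

text \<open>The function \<open>u = (x^2 - 1)^m\<close> satisfies
  \<open>(x^2 - 1) u' = 2 m x u\<close>. Differentiating this \<open>k + 1\<close> times gives the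
  equation, one derivative per induction step.\<close>

lemma rodrigues_ode:
  "[:-1, 0, 1:] * rodrigues m (k + 2) + smult (2 * (real k + 1 - real m)) ([:0, 1:] * rodrigues m (k + 1))
   + smult (real (k + 1) * (real k - 2 * real m)) (rodrigues m k) = 0" (is "?ode k = 0")
proof (induction k)
  case 0
  let ?q = "[:-1, 0, 1:] :: real poly"
  have "?q * pderiv (?q ^ m) = smult (2 * real m) ([:0, 1:] * ?q ^ m)"
  proof (cases m)
    case (Suc j)
    have "pderiv ?q = smult 2 [:0, 1:]" by (simp add: pderiv_pCons)
    then have "?q * pderiv (?q ^ m) = smult (real m * 2) ([:0, 1:] * (?q * ?q ^ j))"
      unfolding Suc pderiv_power_Suc
      by (simp only: mult_smult_left mult_smult_right mult_ac smult_smult)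
    then show ?thesis unfolding Suc by (simp only: power_Suc mult.commute[of 2])
  qed simp
  then have "pderiv (?q * pderiv (?q ^ m)) = pderiv (smult (2 * real m) ([:0, 1:] * ?q ^ m))"
    by simp
  then have "poly (pderiv (?q * pderiv (?q ^ m))) x = poly (pderiv (smult (2 * real m) ([:0, 1:] * ?q ^ m))) x" for x
    by simp
  then have "poly (?ode 0) x = 0" for x
    unfolding pderiv_mult pderiv_smult by (simp add: pderiv_pCons numeral_2_eq_2 algebra_simps)
  then show ?case by (intro poly_ext) (simp only: poly_0)
next
  case (Suc k)
  then have "poly (pderiv (?ode k)) x = 0" for x by simp
  then have "poly (?ode (Suc k)) x = 0" for x
    unfolding pderiv_mult pderiv_smult pderiv_add by (simp add: pderiv_pCons numeral_2_eq_2 algebra_simps)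
  then show ?case by (intro poly_ext) (simp only: poly_0)
qed

section \<open>Legendre's equation and the zeros of the derivative\<close>

lemma degree_legendre_poly: "degree (legendre_poly m) = m"
  by (simp add: legendre_poly_def degree_rodrigues)

text \<open>Legendre's equation in self-adjoint form: the case \<open>k = m\<close> of
  \<open>rodrigues_ode\<close>, unaffected by the normalising constant.\<close>

lemma legendre_ode:
  "pderiv ([:-1, 0, 1:] * pderiv (legendre_poly m)) = smult (real (m + 1) * real m) (legendre_poly m)"
proof -
  let ?q = "[:-1, 0, 1:] :: real poly"
  have "pderiv (?q * pderiv (rodrigues m m)) - smult (real (m + 1) * real m) (rodrigues m m)
    = ?q * rodrigues m (m + 2) + smult (2 * (real m + 1 - real m)) ([:0, 1:] * rodrigues m (m + 1))
      + smult (real (m + 1) * (real m - 2 * real m)) (rodrigues m m)"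
    unfolding pderiv_mult by (intro poly_ext) (simp add: pderiv_pCons algebra_simps)
  also have "\<dots> = 0" by (rule rodrigues_ode)
  finally show ?thesis
    by (simp add: legendre_poly_def pderiv_smult mult_smult_right smult_smult mult.commute
        del: mult_pCons_left mult_pCons_right)
qed

text \<open>Rolle's theorem on the \<open>m\<close> interior zeros of the Legendre polynomial gives
  \<open>m - 1\<close> zeros of its derivative. There are no others, since the derivative has degree
  \<open>m - 1\<close>.\<close>

lemma legendre_critical_points:
  fixes m :: nat
  assumes "m \<ge> 1"
  defines "Z \<equiv> {x. poly (pderiv (legendre_poly m)) x = 0}"
  shows "finite Z" "card Z = m - 1" "Z \<subseteq> {-1<..<1}"
proof -
  obtain B where B: "finite B" "card B = m" "B \<subseteq> {-1<..<1}"
    "\<forall>b\<in>B. poly (rodrigues m m) b = 0"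
    using rodrigues_roots[of m m] by auto
  moreover have "B \<noteq> {}" using B assms(1) by auto
  ultimately obtain C where C: "finite C" "card C + 1 = m" "C \<subseteq> {Min B<..<Max B}"
    "\<forall>b\<in>C. poly (pderiv (legendre_poly m)) b = 0"
    using rolle_roots[of B "legendre_poly m"] by (auto simp: legendre_poly_def)
  have "Min B \<in> B" "Max B \<in> B" using B \<open>B \<noteq> {}\<close> by auto
  then have "C \<subseteq> {-1<..<1}" using B(3) C(3) by fastforce
  have nz: "pderiv (legendre_poly m) \<noteq> 0"
    using assms(1) by (simp add: pderiv_eq_0_iff degree_legendre_poly)
  then show "finite Z" unfolding Z_def by (rule poly_roots_finite)
  moreover have "card Z \<le> card C"
    using card_poly_roots_bound[OF nz] C(2) by (simp add: Z_def degree_pderiv degree_legendre_poly)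
  ultimately have "C = Z" using C(4) by (intro card_seteq) (auto simp: Z_def)
  then show "card Z = m - 1" "Z \<subseteq> {-1<..<1}" using C(2) \<open>C \<subseteq> {-1<..<1}\<close> by auto
qed

section \<open>The differential equation of the node polynomial\<close>

text \<open>Leading coefficients are compared: with \<open>d = degree p\<close>, the term
  \<open>x^2 p''\<close> contributes the factor \<open>d (d - 1)\<close> and \<open>-p''\<close>
  nothing.\<close>

lemma ode_eigenvalue:
  fixes p :: "real poly"
  assumes "[:-1, 0, 1:] * pderiv (pderiv p) = smult c p" "p \<noteq> 0"
  shows "c = real (degree p) * (real (degree p) - 1)"
proof (cases "degree p < 2")
  case True
  then have "pderiv (pderiv p) = 0" by (simp add: pderiv_eq_0_iff degree_pderiv)
  then have "c = 0" using assms by simp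
  moreover have "degree p = 0 \<or> degree p = 1" using True by auto
  ultimately show ?thesis by auto
next
  case False
  then obtain k where k: "degree p = k + 2" by (metis add.commute le_Suc_ex not_less)
  have "coeff ([:-1, 0, 1:] * pderiv (pderiv p)) (k + 2) = coeff (pderiv (pderiv p)) k - coeff (pderiv (pderiv p)) (k + 2)"
    by (simp add: numeral_2_eq_2)
  also have "\<dots> = real (k + 1) * real (k + 2) * coeff p (k + 2)"
    by (simp add: coeff_pderiv coeff_eq_0 k)
  finally have "c * lead_coeff p = real (k + 1) * real (k + 2) * lead_coeff p"
    by (simp only: assms(1) coeff_smult k)
  then have "c = real (k + 1) * real (k + 2)" using assms(2) by simp
  then show ?thesis by (simp add: k algebra_simps)
qed

text \<open>Under the left side, both \<open>omega A\<close> and \<open>W = (x^2 - 1) P'\<close>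
  solve \<open>(x^2 - 1) y'' = \<mu> y\<close> with degree \<open>m + 1\<close>. No nonzero solution
  has lower degree, so they are proportional. Conversely, \<open>W'' = \<mu> P'\<close> vanishes at
  the interior nodes.\<close>

lemma omega_critical_iff:
  fixes m :: nat
  assumes A: "finite A" "card A = m + 1" and m: "m \<ge> 1"
  shows "{-1, 1} \<subseteq> A \<and> (\<forall>a\<in>A - {-1, 1}. poly (pderiv (pderiv (omega A))) a = 0) \<longleftrightarrow>
    A = {-1, 1} \<union> {x. poly (pderiv (legendre_poly m)) x = 0}"
proof -
  define q where "q = [:-1, 0, 1::real:]"
  define W where "W = q * pderiv (legendre_poly m)"
  define N where "N = {-1, 1} \<union> {x. poly (pderiv (legendre_poly m)) x = 0}"
  define \<mu> where "\<mu> = real (m + 1) * real m"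
  have q0: "q \<noteq> 0" "degree q = 2" by (simp_all add: q_def)
  have "poly q x = 0 \<longleftrightarrow> x \<in> {-1, 1}" for x :: real
    using square_eq_1_iff[of x] by (auto simp: q_def algebra_simps)
  then have roots_W: "poly W x = 0 \<longleftrightarrow> x \<in> N" for x
    by (auto simp: W_def N_def)
  have P': "pderiv (legendre_poly m) \<noteq> 0"
    using m by (simp add: pderiv_eq_0_iff degree_legendre_poly)
  then have W: "W \<noteq> 0" "degree W = m + 1"
    using q0 m by (simp_all add: W_def degree_mult_eq degree_pderiv degree_legendre_poly)
  have W'': "pderiv (pderiv W) = smult \<mu> (pderiv (legendre_poly m))"
    unfolding W_def q_def legendre_ode \<mu>_def by (rule pderiv_smult)
  then have W_ode: "q * pderiv (pderiv W) = smult \<mu> W" by (simp add: W_def)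
  have "A = N" if ends: "{-1, 1} \<subseteq> A" and crit: "\<forall>a\<in>A - {-1, 1}. poly (pderiv (pderiv (omega A))) a = 0"
  proof -
    let ?R = "omega (A - {-1, 1})"
    have "omega A = ?R * omega {-1, 1}"
      unfolding omega_def by (rule prod.subset_diff[OF ends A(1)])
    then have \<omega>: "omega A = q * ?R" by (simp add: omega_def q_def)
    have deg: "degree (omega A) = m + 1" using A by (simp add: degree_omega)
    \<comment> \<open>Both \<open>omega''\<close> and \<open>?R\<close> have degree
      \<open>m - 1\<close> and the second divides the first, so they agree up to a constant;
      multiplying by \<open>q\<close> gives the differential equation.\<close>
    have "card (A - {-1, 1}) = m - 1" using A ends by (simp add: card_Diff_subset)
    then have "degree (pderiv (pderiv (omega A))) = degree ?R"
      using deg by (simp add: degree_pderiv degree_omega)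
    moreover have "pderiv (pderiv (omega A)) \<noteq> 0"
      using deg m by (simp add: pderiv_eq_0_iff degree_pderiv)
    moreover have "?R dvd pderiv (pderiv (omega A))"
      using A(1) crit by (intro omega_dvd) auto
    ultimately obtain c where "pderiv (pderiv (omega A)) = smult c ?R"
      using dvd_same_degree by (metis order_refl)
    then have ode: "q * pderiv (pderiv (omega A)) = smult c (omega A)" by (simp add: \<omega>)
    have "omega A \<noteq> 0" using deg by auto
    then have "c = \<mu>" using ode_eigenvalue[of "omega A" c] ode deg by (simp add: q_def \<mu>_def)
    \<comment> \<open>As \<open>omega A\<close> is monic, this \<open>l\<close> cancels the terms of
      degree \<open>m + 1\<close> in \<open>d\<close>.\<close>
    define l where "l = lead_coeff W"
    define d where "d = W - smult l (omega A)"
    have "q * pderiv (pderiv d) = smult \<mu> d"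
      using ode W_ode \<open>c = \<mu>\<close>
      by (simp add: d_def pderiv_diff pderiv_smult right_diff_distrib smult_diff_right mult.commute)
    have "d = 0"
    proof (rule ccontr)
      assume "d \<noteq> 0"
      have "coeff d (m + 1) = 0"
        using lead_coeff_omega[of A] deg W by (simp add: d_def l_def)
      moreover have "degree d \<le> m + 1" using deg W by (auto simp: d_def intro!: degree_diff_le)
      ultimately have "degree d \<le> m"
        using \<open>d \<noteq> 0\<close> by (metis Suc_eq_plus1 le_Suc_eq leading_coeff_0_iff)
      \<comment> \<open>Degree zero is separate because \<open>real (degree d) - 1\<close> is then
        negative, where monotonicity of products fails. The bound lies below
        \<open>\<mu>\<close>.\<close>
      then have "real (degree d) * (real (degree d) - 1) \<le> real m * (real m - 1)"
        using m by (cases "degree d = 0") (auto intro!: mult_mono)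
      moreover have "\<mu> = real (degree d) * (real (degree d) - 1)"
        using ode_eigenvalue[of d \<mu>] \<open>d \<noteq> 0\<close> \<open>q * pderiv (pderiv d) = smult \<mu> d\<close> by (simp add: q_def)
      ultimately show False using m by (simp add: \<mu>_def algebra_simps)
    qed
    then have "W = smult l (omega A)" "l \<noteq> 0" using W by (auto simp: d_def l_def)
    then show "A = N" using roots_W poly_omega[OF A(1)] by auto
  qed
  moreover have "poly (pderiv (pderiv (omega A))) a = 0" if "A = N" and "a \<in> A - {-1, 1}" for a
  proof -
    have "omega A dvd W" using A(1) roots_W that by (intro omega_dvd) auto
    then obtain c where "c \<noteq> 0" "W = smult c (omega A)"
      using dvd_same_degree W A(2) degree_omega[of A] by (metis order_refl)
    moreover have "poly (pderiv (pderiv W)) a = 0" using that by (auto simp: W'' N_def)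
    ultimately show ?thesis by (simp add: pderiv_smult)
  qed
  ultimately show ?thesis unfolding N_def by blast
qed

section \<open>Optimal designs\<close>

lemma lagrange_basis_eq:
  assumes "distinct xs" "j < length xs"
  shows "lagrange_basis xs j x = poly (lagrange_poly (set xs) (xs ! j)) x"
proof -
  have inj: "inj_on ((!) xs) ({..<length xs} - {j})"
    using assms(1) by (auto simp: inj_on_def nth_eq_iff_index_eq)
  have "set xs - {xs ! j} = (!) xs ` ({..<length xs} - {j})"
    using assms by (auto simp: set_conv_nth nth_eq_iff_index_eq)
  then show ?thesis
    by (simp add: lagrange_basis_def lagrange_poly_def omega_def poly_prod prod.reindex[OF inj] prod_dividef)
qed

lemma sum_lagrange_basis_squares:
  assumes "distinct xs"
  shows "(\<Sum>j<length xs. (lagrange_basis xs j x)\<^sup>2) = poly (fejer_poly (set xs)) x"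
proof -
  have "(\<Sum>j<length xs. (lagrange_basis xs j x)\<^sup>2)
      = (\<Sum>j<length xs. (poly (lagrange_poly (set xs) (xs ! j)) x)\<^sup>2)"
    using assms by (simp add: lagrange_basis_eq)
  also have "\<dots> = (\<Sum>a\<in>set xs. (poly (lagrange_poly (set xs) a) x)\<^sup>2)"
    by (rule sum.reindex_bij_betw) (use assms in \<open>simp add: bij_betw_nth\<close>)
  finally show ?thesis by (simp add: fejer_poly_def poly_sum poly_power)
qed

lemma estimator_variance_node:
  assumes "distinct xs" "i < length xs"
  shows "estimator_variance \<sigma> (xs, ns) (xs ! i) = \<sigma>\<^sup>2 / ns ! i"
proof -
  have "(\<Sum>j<length xs. (lagrange_basis xs j (xs ! i))\<^sup>2 / ns ! j)
      = (\<Sum>j<length xs. if j = i then 1 / ns ! i else 0)"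
    using assms
    by (intro sum.cong) (auto simp: lagrange_basis_eq poly_lagrange_poly nth_eq_iff_index_eq)
  also have "\<dots> = 1 / ns ! i" using assms(2) by simp
  finally show ?thesis by (simp add: estimator_variance_def)
qed

lemma estimator_variance_uniform:
  assumes "distinct xs" "\<And>j. j < length xs \<Longrightarrow> ns ! j = w"
  shows "estimator_variance \<sigma> (xs, ns) x = \<sigma>\<^sup>2 / w * poly (fejer_poly (set xs)) x"
  using assms by (simp add: estimator_variance_def flip: sum_lagrange_basis_squares sum_divide_distrib)

text \<open>At a node the variance is \<open>\<sigma>\<^sup>2 / n_j\<close>, so the bound forces
  every \<open>n_j >= n / g\<close>, and the total \<open>n\<close> turns these into equalities.
  With equal frequencies the variance is the bound times \<open>F\<close>, which leaves exactly
  Fejer's condition.\<close>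

lemma max_variance_le_iff:
  fixes g :: nat and n \<sigma> :: real
  assumes "g \<ge> 2" "n > 0" "\<sigma> > 0" and \<xi>: "(xs, ns) \<in> designs g n"
  shows "max_variance \<sigma> (xs, ns) \<le> \<sigma>\<^sup>2 * g / n \<longleftrightarrow>
    set xs = {-1, 1} \<union> {x. poly (pderiv (legendre_poly (g - 1))) x = 0} \<and> (\<forall>j<g. ns ! j = n / g)"
    (is "_ \<longleftrightarrow> ?nodes \<and> ?freqs")
proof -
  have xs: "length xs = g" "distinct xs" "set xs \<subseteq> {-1..1}"
    and ns: "\<And>j. j < g \<Longrightarrow> ns ! j > 0" "(\<Sum>j<g. ns ! j) = n"
    using \<xi> by (auto simp: designs_def strict_sorted_iff)
  have fejer: "?nodes \<longleftrightarrow> (\<forall>x\<in>{-1..1}. poly (fejer_poly (set xs)) x \<le> 1)"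
    using fejer_poly_le_one_iff[of "set xs" "g - 1"] omega_critical_iff[of "set xs" "g - 1"] xs assms(1)
    by (simp add: distinct_card)
  have max: "max_variance \<sigma> (xs, ns) \<le> b \<longleftrightarrow> (\<forall>x\<in>{-1..1}. estimator_variance \<sigma> (xs, ns) x \<le> b)" for b
    using max_variance_attained[of \<sigma> "(xs, ns)"] by (metis order_trans)
  have unif: "max_variance \<sigma> (xs, ns) \<le> \<sigma>\<^sup>2 * g / n \<longleftrightarrow> ?nodes" if ?freqs
    unfolding max fejer using estimator_variance_uniform[of xs ns "n / g" \<sigma>] that xs assms
    by (simp add: mult_le_cancel_left1 field_simps)
  have ?freqs if le: "max_variance \<sigma> (xs, ns) \<le> \<sigma>\<^sup>2 * g / n"
  proof -
    have "ns ! j - n / g \<ge> 0" if "j < g" for j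
    proof -
      have "xs ! j \<in> {-1..1}" using xs that by (metis nth_mem subsetD)
      then have "\<sigma>\<^sup>2 / ns ! j \<le> \<sigma>\<^sup>2 * g / n"
        using le max estimator_variance_node[of xs j \<sigma> ns] xs that by metis
      then show ?thesis using ns(1)[OF that] assms by (simp add: field_simps)
    qed
    moreover have "(\<Sum>j<g. ns ! j - n / g) = 0"
      using ns(2) assms(1) by (simp add: sum_subtractf)
    ultimately have "\<forall>j\<in>{..<g}. ns ! j - n / g = 0"
      by (subst (asm) sum_nonneg_eq_0_iff) auto
    then show ?freqs by auto
  qed
  with unif show ?thesis by blast
qed

theorem proposition16:
  fixes g :: nat and n \<sigma> :: real
  assumes "g \<ge> 2" and "n > 0" and "\<sigma> > 0"
  shows "card {x. poly (pderiv (legendre_poly (g - 1))) x = 0} = g - 2 \<and>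
    (\<exists>!\<xi>. optimal_design g n \<sigma> \<xi>) \<and>
    (\<forall>xs ns. optimal_design g n \<sigma> (xs, ns) \<longrightarrow>
       set xs = {-1, 1} \<union> {x. poly (pderiv (legendre_poly (g - 1))) x = 0} \<and>
       (\<forall>j<g. ns ! j = n / real g))"
proof -
  define Z where "Z = {x. poly (pderiv (legendre_poly (g - 1))) x = 0}"
  define b where "b = \<sigma>\<^sup>2 * g / n"
  define xs0 where "xs0 = sorted_list_of_set ({-1, 1} \<union> Z)"
  define ns0 where "ns0 = replicate g (n / g)"
  have Z: "finite Z" "card Z = g - 2" "Z \<subseteq> {-1<..<1}"
    using legendre_critical_points[of "g - 1"] assms(1) by (simp_all add: Z_def numeral_2_eq_2)
  have le_iff: "max_variance \<sigma> (xs, ns) \<le> b \<longleftrightarrow> set xs = {-1, 1} \<union> Z \<and> (\<forall>j<g. ns ! j = n / g)"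
    if "(xs, ns) \<in> designs g n" for xs ns
    using max_variance_le_iff[OF assms that] by (simp add: b_def Z_def)
  have "card ({-1, 1} \<union> Z) = card {-1, 1::real} + card Z"
    using Z by (intro card_Un_disjoint) auto
  then have "length xs0 = g" using Z(2) assms(1) by (simp add: xs0_def)
  moreover have set_xs0: "set xs0 = {-1, 1} \<union> Z" unfolding xs0_def using Z(1) by (intro set_sorted_list_of_set) auto
  ultimately have \<xi>0: "(xs0, ns0) \<in> designs g n"
    using Z(3) assms by (auto simp: designs_def ns0_def xs0_def)
  have lower: "b \<le> max_variance \<sigma> (xs, ns)" if \<xi>: "(xs, ns) \<in> designs g n" for xs ns
  proof (rule ccontr)
    \<comment> \<open>A value below \<open>b\<close> would still meet the bound in
      \<open>le_iff\<close>, so \<open>n_0 = n / g\<close>; but then the variance at the first node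
      is already \<open>b\<close>.\<close>
    assume "\<not> b \<le> max_variance \<sigma> (xs, ns)"
    moreover from this have "ns ! 0 = n / g" using le_iff[OF \<xi>] assms(1) by auto
    moreover have "distinct xs" "length xs = g" "xs ! 0 \<in> {-1..1}"
      using \<xi> assms(1) by (auto simp: designs_def strict_sorted_iff subset_iff)
    ultimately show False
      using estimator_variance_node[of xs 0 \<sigma> ns] max_variance_attained[of \<sigma> "(xs, ns)"] assms(1)
      by (force simp: b_def)
  qed
  have opt_iff: "optimal_design g n \<sigma> (xs, ns) \<longleftrightarrow>
      (xs, ns) \<in> designs g n \<and> set xs = {-1, 1} \<union> Z \<and> (\<forall>j<g. ns ! j = n / g)" for xs ns
  proof -
    have "max_variance \<sigma> (xs0, ns0) \<le> b" using le_iff[OF \<xi>0] set_xs0 by (simp add: ns0_def)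
    \<comment> \<open>Since \<open>b\<close> is a lower bound attained by the candidate, a design is
      minimal iff its value does not exceed \<open>b\<close>.\<close>
    then have "optimal_design g n \<sigma> (xs, ns) \<longleftrightarrow> (xs, ns) \<in> designs g n \<and> max_variance \<sigma> (xs, ns) \<le> b"
      using lower \<xi>0 unfolding optimal_design_def is_arg_min_def
      by (metis (no_types, opaque_lifting) linorder_not_less order_trans prod.collapse)
    then show ?thesis using le_iff by blast
  qed
  have "\<exists>!\<xi>. optimal_design g n \<sigma> \<xi>"
  proof
    show "optimal_design g n \<sigma> (xs0, ns0)" using \<xi>0 set_xs0 by (simp add: opt_iff ns0_def)
    fix \<xi> assume "optimal_design g n \<sigma> \<xi>"
    then obtain xs ns where \<xi>: "\<xi> = (xs, ns)" "(xs, ns) \<in> designs g n"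
      "set xs = {-1, 1} \<union> Z" "\<forall>j<g. ns ! j = n / g"
      by (cases \<xi>) (auto simp: opt_iff)
    \<comment> \<open>A strictly increasing list is determined by its set of entries.\<close>
    have "xs = xs0"
      unfolding xs0_def \<xi>(3)[symmetric] using \<xi>(2)
      by (simp add: designs_def strict_sorted_iff sorted_list_of_set.idem_if_sorted_distinct)
    moreover have "ns = ns0"
      using \<xi> by (auto simp: designs_def ns0_def intro!: nth_equalityI)
    ultimately show "\<xi> = (xs0, ns0)" using \<xi>(1) by simp
  qed
  then show ?thesis using Z(2) opt_iff unfolding Z_def by blast
qed

end
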